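(* Consider a discrete Nash equilibrium problem with relaxed feasible set $X$. If $X$ is compact, then the Branching Method (described in the context, with any tools $\mathcal{O},\mathcal{S},\mathcal{F},\mathcal{C}$ meeting their specifications) computes the whole solution set of the discrete Nash equilibrium problem; that is, it stops after finitely many steps, and at termination the set $E$ it has built is exactly the set of all equilibria of the discrete Nash equilibrium problem.
   Context: There are $N$ players; player $\nu$ controls $x^\nu\in\mathbb{R}^{n_\nu}$; $n=n_1+\dots+n_N$, $\mathbf{x}=(x^1,\dots,x^N)=(x^\nu,\mathbf{x}^{-\nu})\in\mathbb{R}^n$, where $\mathbf{x}^{-\nu}$ collects the variables of all players other than $\nu$. $X^\nu:=\{x^\nu\in\mathbb{R}^{n_\nu}:g^\nu(x^\nu)\le0\}$ and $X:=\prod_{\nu=1}^N X^\nu$, where $g^\nu:\mathbb{R}^{n_\nu}\to\mathbb{R}^{m_\nu}$. Each player has an objective $\theta_\nu:\mathbb{R}^n\to\mathbb{R}$. Standing assumptions: each $\theta_\nu$ is continuously differentiable and convex as a function of $x^\nu$ alone; each $g^\nu$ is continuously differentiable and (componentwise) convex. Discrete Nash equilibrium problem (NEP): each player $\nu$ solves $\min_{x^\nu}\theta_\nu(x^\nu,\mathbf{x}^{-\nu})$ subject to $x^\nu\in X^\nu\cap\mathbb{Z}^{n_\nu}$; an equilibrium (solution) is $\mathbf{x}_*\in X\cap\mathbb{Z}^n$ such that for all $\nu$, $\theta_\nu(x^\nu_*,\mathbf{x}^{-\nu}_* )\le\theta_\nu(x^\nu,\mathbf{x}^{-\nu}_* )$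 for all $x^\nu\in X^\nu\cap\mathbb{Z}^{n_\nu}$. A box is a product of $n$ closed, possibly unbounded, intervals of $\mathbb{R}$. The tools used by the method are assumed to meet the following specifications whenever they are invoked, where $Y=\prod_\nu Y^\nu$ is a convex set with $Y^\nu\subseteq X^\nu$: - the oracle $\mathcal{O}$ takes $\bar{\mathbf{x}}\in X\cap\mathbb{Z}^n$ and answers YES if and only if $\bar{\mathbf{x}}$ is an equilibrium of the discrete NEP; - the procedure $\mathcal{S}$, given $Y$, yields one equilibrium of the continuous NEP with strategy set $Y$, i.e. a point $\bar{\mathbf{x}}\in Y$ such that for all $\nu$, $\theta_\nu(\bar x^\nu,\bar{\mathbf{x}}^{-\nu})\le\theta_\nu(x^\nu,\bar{\mathbf{x}}^{-\nu})$ for all $x^\nu\in Y^\nu$; - the procedure $\mathcal{F}$, given $Y$ and a point $\bar{\mathbf{x}}$ returned by $\mathcal{S}$, yields a box $B$ such that $Y\setminus B$ contains no equilibrium of the discrete NEP; - the procedure $\mathcal{C}$, given $Y$ and $\bar{\mathbf{x}}\in Y\cap\mathbb{Z}^n$, yields finitely many boxes $\bar B_1,\dots,\bar B_p$ that are pairwise disjoint, with $\bar{\mathbf{x}}\notin\bigcup_{i=1}^p\bar B_i$ and $\tilde{\mathbf{x}}\in\bigcup_{i=1}^p\bar B_i$ for all $\tilde{\mathbf{x}}\in Y\cap\mathbb{Z}^n$ with $\tilde{\mathbf{x}}\ne\bar{\mathbf{x}}$. Branching Method: (S.0) Initialize the list of strategy subsets $\mathcal{L}:=\{X\}$ and the set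 of equilibria $E:=\emptyset$. (S.1) Take (and remove) from $\mathcal{L}$ a strategy set $Y$. (S.2) Use $\mathcal{S}$ to obtain a solution $\bar{\mathbf{x}}$ of the continuous NEP with strategy set $Y$. (S.3) Use $\mathcal{F}$, with $Y$ and $\bar{\mathbf{x}}$, to obtain a box $B$. (S.4) If $\bar{\mathbf{x}}\in\mathbb{Z}^n$ then use $\mathcal{O}$ on $\bar{\mathbf{x}}$: if $\mathcal{O}$ says YES then put $\bar{\mathbf{x}}$ in $E$. (S.5) If $\bar{\mathbf{x}}\in\mathbb{Z}^n$ then use $\mathcal{C}$, with $Y$ and $\bar{\mathbf{x}}$, to obtain $p$ boxes $\bar B_i$; for all $i\in\{1,\dots,p\}$, if $Y\cap B\cap\bar B_i\ne\emptyset$ then put it in $\mathcal{L}$; go to (S.7). (S.6) (Reached when $\bar{\mathbf{x}}\notin\mathbb{Z}^n$.) Find an index $i\in\{1,\dots,n\}$ such that $\bar{\mathbf{x}}_i\notin\mathbb{Z}$; if $Y\cap B\cap\{\mathbf{x}\in\mathbb{R}^n:\mathbf{x}_i\ge\lceil\bar{\mathbf{x}}_i\rceil\}\ne\emptyset$ then put it in $\mathcal{L}$; if $Y\cap B\cap\{\mathbf{x}\in\mathbb{R}^n:\mathbf{x}_i\le\lfloor\bar{\mathbf{x}}_i\rfloor\}\ne\emptyset$ then put it in $\mathcal{L}$. (S.7) If $\mathcal{L}=\emptyset$ then stop, else go to (S.1). *)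

theory Defs
  imports "HOL-Analysis.Analysis" "HOL-Library.Multiset"
begin

text \<open>
  The coordinates of the joint space \<open>real ^ 'i\<close> are distributed among the players \<open>'p\<close> by a map
  \<open>own :: 'i \<Rightarrow> 'p\<close>. The blocks may have different sizes, so the strategy space of player \<open>\<nu>\<close>
  is rendered as the coordinate subspace of the vectors supported on the block of \<open>\<nu>\<close>.
\<close>

definition player_space :: "('i::finite \<Rightarrow> 'p) \<Rightarrow> 'p \<Rightarrow> (real ^ 'i) set" where
  "player_space own \<nu> = {y. \<forall>i. own i \<noteq> \<nu> \<longrightarrow> y $ i = 0}"

definition block :: "('i::finite \<Rightarrow> 'p) \<Rightarrow> 'p \<Rightarrow> real ^ 'i \<Rightarrow> real ^ 'i" where
  "block own \<nu> x = (\<chi> i. if own i = \<nu> then x $ i else 0)"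

text \<open>\<open>deviate own \<nu> y x\<close> is the joint strategy \<open>(y, x\<^sup>-\<^sup>\<nu>)\<close>.\<close>

definition deviate :: "('i::finite \<Rightarrow> 'p) \<Rightarrow> 'p \<Rightarrow> real ^ 'i \<Rightarrow> real ^ 'i \<Rightarrow> real ^ 'i" where
  "deviate own \<nu> y x = (\<chi> i. if own i = \<nu> then y $ i else x $ i)"

definition int_points :: "(real ^ 'i::finite) set" where
  "int_points = {x. \<forall>i. x $ i \<in> \<int>}"

definition is_box :: "(real ^ 'i::finite) set \<Rightarrow> bool" where
  "is_box B \<longleftrightarrow> (\<exists>I :: 'i \<Rightarrow> real set.
     (\<forall>i. is_interval (I i) \<and> closed (I i)) \<and> B = {x. \<forall>i. x $ i \<in> I i})"

text \<open>Only used for \<open>S\<close> the whole space or a coordinate subspace. In the latter case only the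
  projection of the gradient \<open>G x\<close> to \<open>S\<close> is determined.\<close>

definition cont_diff_on :: "(real ^ 'i::finite) set \<Rightarrow> (real ^ 'i \<Rightarrow> real) \<Rightarrow> bool" where
  "cont_diff_on S f \<longleftrightarrow> (\<exists>G. continuous_on S G \<and>
     (\<forall>x\<in>S. (f has_derivative (\<lambda>h. G x \<bullet> h)) (at x within S)))"

text \<open>\<open>g \<nu> j\<close>, for \<open>j < m \<nu>\<close>, are the components of the constraint map of player \<open>\<nu>\<close>.
  Only its values on \<open>player_space own \<nu>\<close> are relevant.\<close>

definition nep_assms ::
  "('i::finite \<Rightarrow> 'p) \<Rightarrow> ('p \<Rightarrow> real ^ 'i \<Rightarrow> real) \<Rightarrow> ('p \<Rightarrow> nat) \<Rightarrow>
   ('p \<Rightarrow> nat \<Rightarrow> real ^ 'i \<Rightarrow> real) \<Rightarrow> bool" where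
  "nep_assms own \<theta> m g \<longleftrightarrow>
     (\<forall>\<nu>. cont_diff_on UNIV (\<theta> \<nu>)) \<and>
     (\<forall>\<nu> x. convex_on (player_space own \<nu>) (\<lambda>y. \<theta> \<nu> (deviate own \<nu> y x))) \<and>
     (\<forall>\<nu>. \<forall>j<m \<nu>. cont_diff_on (player_space own \<nu>) (g \<nu> j) \<and>
                   convex_on (player_space own \<nu>) (g \<nu> j))"

definition player_feasible ::
  "('i::finite \<Rightarrow> 'p) \<Rightarrow> ('p \<Rightarrow> nat) \<Rightarrow> ('p \<Rightarrow> nat \<Rightarrow> real ^ 'i \<Rightarrow> real) \<Rightarrow> 'p \<Rightarrow> (real ^ 'i) set" where
  "player_feasible own m g \<nu> = {y \<in> player_space own \<nu>. \<forall>j<m \<nu>. g \<nu> j y \<le> 0}"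

definition joint_product ::
  "('i::finite \<Rightarrow> 'p) \<Rightarrow> ('p \<Rightarrow> (real ^ 'i) set) \<Rightarrow> (real ^ 'i) set" where
  "joint_product own Z = {x. \<forall>\<nu>. block own \<nu> x \<in> Z \<nu>}"

definition feasible ::
  "('i::finite \<Rightarrow> 'p) \<Rightarrow> ('p \<Rightarrow> nat) \<Rightarrow> ('p \<Rightarrow> nat \<Rightarrow> real ^ 'i \<Rightarrow> real) \<Rightarrow> (real ^ 'i) set" where
  "feasible own m g = joint_product own (player_feasible own m g)"

definition discrete_equilibria ::
  "('i::finite \<Rightarrow> 'p) \<Rightarrow> ('p \<Rightarrow> real ^ 'i \<Rightarrow> real) \<Rightarrow> ('p \<Rightarrow> nat) \<Rightarrow>
   ('p \<Rightarrow> nat \<Rightarrow> real ^ 'i \<Rightarrow> real) \<Rightarrow> (real ^ 'i) set" where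
  "discrete_equilibria own \<theta> m g =
     {x \<in> feasible own m g \<inter> int_points.
        \<forall>\<nu>. \<forall>y \<in> player_feasible own m g \<nu> \<inter> int_points. \<theta> \<nu> x \<le> \<theta> \<nu> (deviate own \<nu> y x)}"

definition strategy_set ::
  "('i::finite \<Rightarrow> 'p) \<Rightarrow> ('p \<Rightarrow> nat) \<Rightarrow> ('p \<Rightarrow> nat \<Rightarrow> real ^ 'i \<Rightarrow> real) \<Rightarrow> (real ^ 'i) set \<Rightarrow> bool" where
  "strategy_set own m g Y \<longleftrightarrow> convex Y \<and>
     (\<exists>Z. (\<forall>\<nu>. Z \<nu> \<subseteq> player_feasible own m g \<nu>) \<and> Y = joint_product own Z)"

text \<open>The factors of a nonempty product \<open>Y\<close> are its projections \<open>block own \<nu> ` Y\<close>.\<close>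

definition continuous_equilibrium ::
  "('i::finite \<Rightarrow> 'p) \<Rightarrow> ('p \<Rightarrow> real ^ 'i \<Rightarrow> real) \<Rightarrow> (real ^ 'i) set \<Rightarrow> real ^ 'i \<Rightarrow> bool" where
  "continuous_equilibrium own \<theta> Y x \<longleftrightarrow>
     x \<in> Y \<and> (\<forall>\<nu>. \<forall>y \<in> block own \<nu> ` Y. \<theta> \<nu> x \<le> \<theta> \<nu> (deviate own \<nu> y x))"

text \<open>
  A tool is a relation between its inputs and its possible outputs, so it need not be
  deterministic; the oracle is the predicate ``the answer is YES''. One step is one full
  iteration of the method, on states consisting of the list of strategy subsets (as a
  multiset, so that any element may be taken next) and the set \<open>E\<close>.
\<close>

type_synonym 'i solver = "(real ^ 'i) set \<Rightarrow> real ^ 'i \<Rightarrow> bool"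
type_synonym 'i box_tool = "(real ^ 'i) set \<Rightarrow> real ^ 'i \<Rightarrow> (real ^ 'i) set \<Rightarrow> bool"
type_synonym 'i cut_tool = "(real ^ 'i) set \<Rightarrow> real ^ 'i \<Rightarrow> (real ^ 'i) set list \<Rightarrow> bool"
type_synonym 'i bm_state = "(real ^ 'i) set multiset \<times> (real ^ 'i) set"

inductive bm_step ::
  "(real ^ 'i::finite \<Rightarrow> bool) \<Rightarrow> 'i solver \<Rightarrow> 'i box_tool \<Rightarrow> 'i cut_tool \<Rightarrow>
   'i bm_state \<Rightarrow> 'i bm_state \<Rightarrow> bool"
  for Orac Solv Filt Cut where
  integral:
    "\<lbrakk>Solv Y x; Filt Y x B; x \<in> int_points; Cut Y x Bs\<rbrakk> \<Longrightarrow>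
     bm_step Orac Solv Filt Cut
       (add_mset Y L, E)
       (L + {#W \<in># mset (map (\<lambda>B'. Y \<inter> B \<inter> B') Bs). W \<noteq> {}#},
        if Orac x then insert x E else E)"
| fractional:
    "\<lbrakk>Solv Y x; Filt Y x B; x \<notin> int_points; x $ i \<notin> \<int>\<rbrakk> \<Longrightarrow>
     bm_step Orac Solv Filt Cut
       (add_mset Y L, E)
       (L + {#W \<in># {#Y \<inter> B \<inter> {z. z $ i \<ge> of_int \<lceil>x $ i\<rceil>},
                     Y \<inter> B \<inter> {z. z $ i \<le> of_int \<lfloor>x $ i\<rfloor>}#}. W \<noteq> {}#},
        E)"

definition bm_init ::
  "('i::finite \<Rightarrow> 'p) \<Rightarrow> ('p \<Rightarrow> nat) \<Rightarrow> ('p \<Rightarrow> nat \<Rightarrow> real ^ 'i \<Rightarrow> real) \<Rightarrow> 'i bm_state" where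
  "bm_init own m g = ({#feasible own m g#}, {})"

definition oracle_spec ::
  "('i::finite \<Rightarrow> 'p) \<Rightarrow> ('p \<Rightarrow> real ^ 'i \<Rightarrow> real) \<Rightarrow> ('p \<Rightarrow> nat) \<Rightarrow>
   ('p \<Rightarrow> nat \<Rightarrow> real ^ 'i \<Rightarrow> real) \<Rightarrow> (real ^ 'i \<Rightarrow> bool) \<Rightarrow> real ^ 'i \<Rightarrow> bool" where
  "oracle_spec own \<theta> m g Orac x \<longleftrightarrow>
     (x \<in> feasible own m g \<inter> int_points \<longrightarrow> (Orac x \<longleftrightarrow> x \<in> discrete_equilibria own \<theta> m g))"

definition solver_spec ::
  "('i::finite \<Rightarrow> 'p) \<Rightarrow> ('p \<Rightarrow> real ^ 'i \<Rightarrow> real) \<Rightarrow> ('p \<Rightarrow> nat) \<Rightarrow>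
   ('p \<Rightarrow> nat \<Rightarrow> real ^ 'i \<Rightarrow> real) \<Rightarrow> 'i solver \<Rightarrow> (real ^ 'i) set \<Rightarrow> bool" where
  "solver_spec own \<theta> m g Solv Y \<longleftrightarrow>
     (strategy_set own m g Y \<longrightarrow>
        (\<exists>x. Solv Y x) \<and> (\<forall>x. Solv Y x \<longrightarrow> continuous_equilibrium own \<theta> Y x))"

definition filter_spec ::
  "('i::finite \<Rightarrow> 'p) \<Rightarrow> ('p \<Rightarrow> real ^ 'i \<Rightarrow> real) \<Rightarrow> ('p \<Rightarrow> nat) \<Rightarrow>
   ('p \<Rightarrow> nat \<Rightarrow> real ^ 'i \<Rightarrow> real) \<Rightarrow> 'i box_tool \<Rightarrow> (real ^ 'i) set \<Rightarrow> real ^ 'i \<Rightarrow> bool" where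
  "filter_spec own \<theta> m g Filt Y x \<longleftrightarrow>
     (strategy_set own m g Y \<longrightarrow>
        (\<exists>B. Filt Y x B) \<and>
        (\<forall>B. Filt Y x B \<longrightarrow> is_box B \<and> (Y - B) \<inter> discrete_equilibria own \<theta> m g = {}))"

definition cut_spec ::
  "('i::finite \<Rightarrow> 'p) \<Rightarrow> ('p \<Rightarrow> nat) \<Rightarrow> ('p \<Rightarrow> nat \<Rightarrow> real ^ 'i \<Rightarrow> real) \<Rightarrow>
   'i cut_tool \<Rightarrow> (real ^ 'i) set \<Rightarrow> real ^ 'i \<Rightarrow> bool" where
  "cut_spec own m g Cut Y x \<longleftrightarrow>
     (strategy_set own m g Y \<and> x \<in> Y \<inter> int_points \<longrightarrow>
        (\<exists>Bs. Cut Y x Bs) \<and>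
        (\<forall>Bs. Cut Y x Bs \<longrightarrow>
           (\<forall>B \<in> set Bs. is_box B) \<and>
           (\<forall>i < length Bs. \<forall>j < length Bs. i \<noteq> j \<longrightarrow> Bs ! i \<inter> Bs ! j = {}) \<and>
           x \<notin> \<Union> (set Bs) \<and>
           (\<forall>z \<in> Y \<inter> int_points. z \<noteq> x \<longrightarrow> z \<in> \<Union> (set Bs))))"

text \<open>The specifications are required only for the inputs that occur in some run of the method.
  They cannot be required for every strategy set, since a noncompact \<open>Y\<close> may have no continuous
  equilibrium at all.\<close>

definition tools_meet_specs ::
  "('i::finite \<Rightarrow> 'p) \<Rightarrow> ('p \<Rightarrow> real ^ 'i \<Rightarrow> real) \<Rightarrow> ('p \<Rightarrow> nat) \<Rightarrow>
   ('p \<Rightarrow> nat \<Rightarrow> real ^ 'i \<Rightarrow> real) \<Rightarrow>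
   (real ^ 'i \<Rightarrow> bool) \<Rightarrow> 'i solver \<Rightarrow> 'i box_tool \<Rightarrow> 'i cut_tool \<Rightarrow> bool" where
  "tools_meet_specs own \<theta> m g Orac Solv Filt Cut \<longleftrightarrow>
     (\<forall>L E Y. (bm_step Orac Solv Filt Cut)\<^sup>*\<^sup>* (bm_init own m g) (L, E) \<longrightarrow> Y \<in># L \<longrightarrow>
        solver_spec own \<theta> m g Solv Y \<and>
        (\<forall>x. Solv Y x \<longrightarrow>
           filter_spec own \<theta> m g Filt Y x \<and>
           (x \<in> int_points \<longrightarrow> oracle_spec own \<theta> m g Orac x \<and> cut_spec own m g Cut Y x)))"

end

theory Submission
  imports Defs
begin

text \<open>
  Every set in the list is the feasible set cut down by boxes, hence again a convex product of
  player-wise factors, so the tools apply to it. No equilibrium is ever lost: the filter discards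
  none, the two half-spaces of a fractional branching contain every integer point, and the cut
  boxes contain every integer point but the one handed to the oracle. Hence at each moment
  every equilibrium lies in \<open>E\<close> or in a set still in the list
  (\<open>bm_invariant_reachable\<close>), which gives the answer once the list is empty.

  Counting integer points does not prove termination, because a fractional branching need not
  remove any. Instead, \<open>\<real>\<^sup>n\<close> is partitioned into the cells on which floor and ceiling of all
  coordinates are constant, i.e. into products of singletons \<open>{k}\<close> and open intervals
  \<open>(k, k + 1)\<close> with \<open>k\<close> an integer. A bounded set meets finitely many cells
  (\<open>finite_cells\<close>), and whichever branching takes place, all the sets that replace \<open>Y\<close> miss
  the cell of the point \<open>x\<close> computed in \<open>Y\<close> (\<open>bm_step_branching\<close>). So one step replaces an
  element of the list by finitely many sets that meet fewer cells, and the multiset ordering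
  is well-founded.
\<close>

section \<open>Cells of the integer grid\<close>

text \<open>
  Floor alone would identify an integer point with the fractional points above it; the ceiling
  is what makes \<open>{k}\<close> and \<open>(k, k + 1)\<close> different cells.
\<close>

definition cell :: "real ^ 'i::finite \<Rightarrow> 'i \<Rightarrow> int \<times> int" where
  "cell z = (\<lambda>i. (\<lfloor>z $ i\<rfloor>, \<lceil>z $ i\<rceil>))"

lemma cell_eq_iff:
  "cell z = cell x \<longleftrightarrow> (\<forall>i. \<lfloor>z $ i\<rfloor> = \<lfloor>x $ i\<rfloor> \<and> \<lceil>z $ i\<rceil> = \<lceil>x $ i\<rceil>)"
  by (auto simp: cell_def fun_eq_iff)

lemma finite_cells:
  fixes S :: "(real ^ 'i::finite) set"
  assumes "bounded S"
  shows "finite (cell ` S)"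
proof -
  obtain b where b: "\<And>z. z \<in> S \<Longrightarrow> norm z \<le> b"
    using assms by (auto simp: bounded_iff)
  let ?T = "{\<lfloor>- b\<rfloor>..\<lceil>b\<rceil>} \<times> {\<lfloor>- b\<rfloor>..\<lceil>b\<rceil>}"
  have "cell z i \<in> ?T" if "z \<in> S" for z i
  proof -
    have "\<bar>z $ i\<bar> \<le> b"
      using component_le_norm_cart[of z i] b[OF that] by linarith
    then have le: "- b \<le> z $ i" "z $ i \<le> b"
      by linarith+
    show ?thesis
      using floor_mono[OF le(1)] ceiling_mono[OF le(2)] floor_le_ceiling[of "z $ i"]
      unfolding cell_def by simp linarith
  qed
  then have "cell ` S \<subseteq> Pi\<^sub>E UNIV (\<lambda>_. ?T)"
    by auto
  then show ?thesis
    by (rule finite_subset) (intro finite_PiE; simp)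
qed

text \<open>An integer point is alone in its cell, so a branching at \<open>x\<close> only has to exclude \<open>x\<close>.\<close>

lemma cell_eq_integer_point:
  assumes "x \<in> int_points" "cell z = cell x"
  shows "z = x"
proof -
  have "z $ i = x $ i" for i
  proof -
    obtain k where "x $ i = of_int k"
      using assms(1) by (auto simp: int_points_def elim: Ints_cases)
    then have "\<lfloor>z $ i\<rfloor> = k" "\<lceil>z $ i\<rceil> = k"
      using assms(2) by (auto simp: cell_eq_iff)
    then show ?thesis
      using \<open>x $ i = of_int k\<close> by linarith
  qed
  then show ?thesis
    by (simp add: vec_eq_iff)
qed

text \<open>
  Rounding the bounds of the two half-spaces removes all of the open interval between consecutive
  integers that contains \<open>x $ i\<close>, and the whole cell of \<open>x\<close> lies over this interval.
\<close>

lemma cell_neq_fractional: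
  assumes "x $ i \<notin> \<int>" and "z $ i \<ge> of_int \<lceil>x $ i\<rceil> \<or> z $ i \<le> of_int \<lfloor>x $ i\<rfloor>"
  shows "cell z \<noteq> cell x"
proof
  assume "cell z = cell x"
  then have eq: "\<lfloor>z $ i\<rfloor> = \<lfloor>x $ i\<rfloor>" "\<lceil>z $ i\<rceil> = \<lceil>x $ i\<rceil>"
    by (auto simp: cell_eq_iff)
  have "\<lfloor>x $ i\<rfloor> < \<lceil>x $ i\<rceil>"
    using assms(1) floor_le_ceiling[of "x $ i"] le_of_int_ceiling[of "x $ i"] of_int_floor_le[of "x $ i"]
    by (metis Ints_of_int order_antisym order_less_le)
  then show False
    using assms(2) eq by linarith
qed

section \<open>Boxes and strategy sets\<close>

lemma is_box_Int:
  assumes "is_box B" "is_box C"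
  shows "is_box (B \<inter> C)"
proof -
  obtain I J where
    "\<forall>i. is_interval (I i) \<and> closed (I i)" "B = {x. \<forall>i. x $ i \<in> I i}"
    "\<forall>i. is_interval (J i) \<and> closed (J i)" "C = {x. \<forall>i. x $ i \<in> J i}"
    using assms unfolding is_box_def by auto
  then show ?thesis
    unfolding is_box_def
    by (intro exI[of _ "\<lambda>i. I i \<inter> J i"]) (auto simp: is_interval_Int)
qed

lemma is_box_coordinate:
  assumes "is_interval S" "closed S"
  shows "is_box {x :: real ^ 'i::finite. x $ i \<in> S}"
  unfolding is_box_def
  by (rule exI[of _ "\<lambda>j. if j = i then S else UNIV"]) (use assms in auto)

lemma convex_is_box:
  assumes "is_box B"
  shows "convex B"
proof -
  obtain I where I: "\<forall>i. is_interval (I i) \<and> closed (I i)" and B: "B = {x. \<forall>i. x $ i \<in> I i}"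
    using assms unfolding is_box_def by (elim exE conjE)
  have "convex (I i)" for i
    using I by (simp add: is_interval_convex)
  then show ?thesis
    unfolding B convex_def by simp
qed

text \<open>A box constrains each coordinate separately, so it splits along the players' blocks.\<close>

lemma strategy_set_Int_box:
  assumes "strategy_set own m g Y" "is_box B"
  shows "strategy_set own m g (Y \<inter> B)"
proof -
  obtain Z where Z: "\<And>\<nu>. Z \<nu> \<subseteq> player_feasible own m g \<nu>" and Y: "Y = joint_product own Z"
    and "convex Y"
    using assms(1) unfolding strategy_set_def by auto
  obtain I where B: "B = {x. \<forall>i. x $ i \<in> I i}"
    using assms(2) unfolding is_box_def by auto
  let ?Z = "\<lambda>\<nu>. {y \<in> Z \<nu>. \<forall>i. own i = \<nu> \<longrightarrow> y $ i \<in> I i}"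
  have "Y \<inter> B = joint_product own ?Z"
    unfolding Y B by (auto simp: joint_product_def block_def)
  moreover have "convex (Y \<inter> B)"
    using \<open>convex Y\<close> convex_is_box[OF assms(2)] by (rule convex_Int)
  moreover have "\<forall>\<nu>. ?Z \<nu> \<subseteq> player_feasible own m g \<nu>"
    using Z by blast
  ultimately show ?thesis
    unfolding strategy_set_def by (intro conjI exI[of _ ?Z])
qed

lemma strategy_set_subset_feasible:
  assumes "strategy_set own m g Y"
  shows "Y \<subseteq> feasible own m g"
  using assms unfolding strategy_set_def feasible_def joint_product_def by blast

lemma convex_player_feasible:
  assumes "nep_assms own \<theta> m g"
  shows "convex (player_feasible own m g \<nu>)"
proof (rule convexI)
  fix x y and u v :: real
  assume x: "x \<in> player_feasible own m g \<nu>" and y: "y \<in> player_feasible own m g \<nu>"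
    and uv: "0 \<le> u" "0 \<le> v" "u + v = 1"
  have "g \<nu> j (u *\<^sub>R x + v *\<^sub>R y) \<le> 0" if "j < m \<nu>" for j
  proof -
    have "convex_on (player_space own \<nu>) (g \<nu> j)"
      using assms that unfolding nep_assms_def by blast
    moreover have "x \<in> player_space own \<nu>" "y \<in> player_space own \<nu>" "g \<nu> j x \<le> 0" "g \<nu> j y \<le> 0"
      using x y that by (auto simp: player_feasible_def)
    ultimately have "g \<nu> j (u *\<^sub>R x + v *\<^sub>R y) \<le> u * g \<nu> j x + v * g \<nu> j y"
      using uv unfolding convex_on_def by blast
    also have "\<dots> \<le> 0"
      using uv \<open>g \<nu> j x \<le> 0\<close> \<open>g \<nu> j y \<le> 0\<close> by (simp add: add_nonpos_nonpos mult_nonneg_nonpos)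
    finally show ?thesis .
  qed
  moreover have "u *\<^sub>R x + v *\<^sub>R y \<in> player_space own \<nu>"
    using x y by (auto simp: player_feasible_def player_space_def)
  ultimately show "u *\<^sub>R x + v *\<^sub>R y \<in> player_feasible own m g \<nu>"
    by (simp add: player_feasible_def)
qed

lemma strategy_set_feasible:
  assumes "nep_assms own \<theta> m g"
  shows "strategy_set own m g (feasible own m g)"
proof -
  have block: "block own \<nu> (u *\<^sub>R x + v *\<^sub>R y) = u *\<^sub>R block own \<nu> x + v *\<^sub>R block own \<nu> y"
    for \<nu> u v x y
    by (simp add: block_def vec_eq_iff)
  have "convex (feasible own m g)"
    unfolding feasible_def joint_product_def
    by (rule convexI) (use convex_player_feasible[OF assms] in \<open>simp add: block convexD\<close>)
  then show ?thesis
    unfolding strategy_set_def feasible_def by blast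
qed

section \<open>Steps of the branching method\<close>

definition bm_invariant ::
  "('i::finite \<Rightarrow> 'p) \<Rightarrow> ('p \<Rightarrow> real ^ 'i \<Rightarrow> real) \<Rightarrow> ('p \<Rightarrow> nat) \<Rightarrow>
   ('p \<Rightarrow> nat \<Rightarrow> real ^ 'i \<Rightarrow> real) \<Rightarrow> 'i bm_state \<Rightarrow> bool" where
  "bm_invariant own \<theta> m g s \<longleftrightarrow>
     (\<forall>Y \<in># fst s. strategy_set own m g Y) \<and>
     snd s \<subseteq> discrete_equilibria own \<theta> m g \<and>
     discrete_equilibria own \<theta> m g \<subseteq> snd s \<union> \<Union> (set_mset (fst s))"

text \<open>
  What the two kinds of branching have in common; both correctness and termination use steps only
  through it. The sets in \<open>K\<close> replace \<open>Y\<close>. They miss the cell of \<open>x\<close> because a cut removes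
  the point \<open>x\<close>, which is a whole cell when it is integer, and a fractional branching removes an
  open strip containing the cell. An equilibrium in \<open>Y\<close> passes the filter and, being integer,
  lies in one of the pieces, unless it is \<open>x\<close> itself, which the oracle then recognizes.
\<close>

lemma bm_step_branching:
  fixes own :: "'i::finite \<Rightarrow> 'p"
  assumes step: "bm_step Orac Solv Filt Cut (L, E) (L', E')"
    and reach: "(bm_step Orac Solv Filt Cut)\<^sup>*\<^sup>* (bm_init own m g) (L, E)"
    and specs: "tools_meet_specs own \<theta> m g Orac Solv Filt Cut"
    and strat: "\<forall>Y \<in># L. strategy_set own m g Y"
  obtains Y R K x where
    "L = add_mset Y R" "L' = R + K" "x \<in> Y"
    "\<And>W. W \<in># K \<Longrightarrow> \<exists>C. is_box C \<and> W = Y \<inter> C"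
    "\<And>W. W \<in># K \<Longrightarrow> cell x \<notin> cell ` W"
    "E \<subseteq> E'" "E' \<subseteq> E \<union> discrete_equilibria own \<theta> m g"
    "discrete_equilibria own \<theta> m g \<inter> Y \<subseteq> E' \<union> \<Union> (set_mset K)"
  using step
proof (cases rule: bm_step.cases)
  case (integral Y x B Bs R)
  have "Y \<in># L"
    using integral by simp
  note Y = bspec[OF strat this]
  have "solver_spec own \<theta> m g Solv Y" "filter_spec own \<theta> m g Filt Y x"
    and orac: "oracle_spec own \<theta> m g Orac x" and cut: "cut_spec own m g Cut Y x"
    using specs reach \<open>Y \<in># L\<close> integral unfolding tools_meet_specs_def by blast+
  then have "x \<in> Y" and B: "is_box B" "(Y - B) \<inter> discrete_equilibria own \<theta> m g = {}"
    using Y integral unfolding solver_spec_def filter_spec_def continuous_equilibrium_def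
    by blast+
  have Bs: "\<And>C. C \<in> set Bs \<Longrightarrow> is_box C" "x \<notin> \<Union> (set Bs)"
    "\<And>z. z \<in> Y \<inter> int_points \<Longrightarrow> z \<noteq> x \<Longrightarrow> z \<in> \<Union> (set Bs)"
    using cut Y \<open>x \<in> Y\<close> integral unfolding cut_spec_def by blast+
  have x: "Orac x \<longleftrightarrow> x \<in> discrete_equilibria own \<theta> m g"
    using orac strategy_set_subset_feasible[OF Y] \<open>x \<in> Y\<close> integral
    unfolding oracle_spec_def by blast
  let ?K = "{#W \<in># mset (map (\<lambda>B'. Y \<inter> B \<inter> B') Bs). W \<noteq> {}#}"
  show thesis
  proof (rule that[of Y R ?K x])
    fix W assume "W \<in># ?K"
    then obtain C where C: "C \<in> set Bs" "W = Y \<inter> B \<inter> C"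
      by auto
    then show "\<exists>C. is_box C \<and> W = Y \<inter> C"
      using is_box_Int[OF B(1) Bs(1)] by (metis Int_assoc)
    have "x \<notin> W"
      using C Bs(2) by blast
    then show "cell x \<notin> cell ` W"
      using cell_eq_integer_point[OF \<open>x \<in> int_points\<close>] by (metis imageE)
  next
    show "discrete_equilibria own \<theta> m g \<inter> Y \<subseteq> E' \<union> \<Union> (set_mset ?K)"
    proof
      fix z assume z: "z \<in> discrete_equilibria own \<theta> m g \<inter> Y"
      then have "z \<in> Y \<inter> int_points" "z \<in> B"
        using B(2) by (auto simp: discrete_equilibria_def)
      show "z \<in> E' \<union> \<Union> (set_mset ?K)"
      proof (cases "z = x")
        case True
        then show ?thesis
          using x z integral by auto
      next
        case False
        then obtain C where "C \<in> set Bs" "z \<in> C"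
          using Bs(3)[OF \<open>z \<in> Y \<inter> int_points\<close>] by blast
        then have "Y \<inter> B \<inter> C \<in># ?K" "z \<in> Y \<inter> B \<inter> C"
          using \<open>z \<in> B\<close> z by auto
        then show ?thesis
          by blast
      qed
    qed
  qed (use integral x \<open>x \<in> Y\<close> in auto)
next
  case (fractional Y x B i R)
  have "Y \<in># L"
    using fractional by simp
  note Y = bspec[OF strat this]
  have "solver_spec own \<theta> m g Solv Y" "filter_spec own \<theta> m g Filt Y x"
    using specs reach \<open>Y \<in># L\<close> fractional unfolding tools_meet_specs_def by blast+
  then have "x \<in> Y" and B: "is_box B" "(Y - B) \<inter> discrete_equilibria own \<theta> m g = {}"
    using Y fractional unfolding solver_spec_def filter_spec_def continuous_equilibrium_def
    by blast+
  let ?U = "{z :: real ^ 'i. z $ i \<ge> of_int \<lceil>x $ i\<rceil>}"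
  let ?D = "{z :: real ^ 'i. z $ i \<le> of_int \<lfloor>x $ i\<rfloor>}"
  let ?K = "{#W \<in># {#Y \<inter> B \<inter> ?U, Y \<inter> B \<inter> ?D#}. W \<noteq> {}#}"
  have box: "is_box ?U" "is_box ?D"
    using is_box_coordinate[of "{of_int \<lceil>x $ i\<rceil>..}" i]
      is_box_coordinate[of "{..of_int \<lfloor>x $ i\<rfloor>}" i]
    by (simp_all add: is_interval_ci is_interval_ic)
  show thesis
  proof (rule that[of Y R ?K x])
    fix W assume "W \<in># ?K"
    then have W: "W = Y \<inter> B \<inter> ?U \<or> W = Y \<inter> B \<inter> ?D"
      by (auto split: if_splits)
    then show "\<exists>C. is_box C \<and> W = Y \<inter> C"
      using is_box_Int[OF B(1) box(1)] is_box_Int[OF B(1) box(2)] by (metis Int_assoc)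
    show "cell x \<notin> cell ` W"
    proof
      assume "cell x \<in> cell ` W"
      then obtain z where "z \<in> W" "cell z = cell x"
        by (metis imageE)
      then show False
        using W cell_neq_fractional[OF \<open>x $ i \<notin> \<int>\<close>, of z] by auto
    qed
  next
    show "discrete_equilibria own \<theta> m g \<inter> Y \<subseteq> E' \<union> \<Union> (set_mset ?K)"
    proof
      fix z assume z: "z \<in> discrete_equilibria own \<theta> m g \<inter> Y"
      then have "z \<in> B" "z $ i \<in> \<int>"
        using B(2) by (auto simp: discrete_equilibria_def int_points_def)
      obtain k where k: "z $ i = of_int k"
        using \<open>z $ i \<in> \<int>\<close> by (auto elim: Ints_cases)
      \<comment> \<open>No integer lies strictly between the floor and the ceiling of \<open>x $ i\<close>.\<close>
      have "z \<in> ?U \<or> z \<in> ?D"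
        unfolding mem_Collect_eq k of_int_le_iff ceiling_le_iff le_floor_iff by linarith
      then have "(z \<in> Y \<inter> B \<inter> ?U \<and> Y \<inter> B \<inter> ?U \<in># ?K) \<or> (z \<in> Y \<inter> B \<inter> ?D \<and> Y \<inter> B \<inter> ?D \<in># ?K)"
        using z \<open>z \<in> B\<close> by auto
      then show "z \<in> E' \<union> \<Union> (set_mset ?K)"
        by blast
    qed
  qed (use fractional \<open>x \<in> Y\<close> in auto)
qed

lemma bm_invariant_reachable:
  assumes nep: "nep_assms own \<theta> m g"
    and specs: "tools_meet_specs own \<theta> m g Orac Solv Filt Cut"
    and reach: "(bm_step Orac Solv Filt Cut)\<^sup>*\<^sup>* (bm_init own m g) s"
  shows "bm_invariant own \<theta> m g s"
  using reach
proof (induction rule: rtranclp_induct)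
  case base
  show ?case
    using strategy_set_feasible[OF nep]
    by (auto simp: bm_invariant_def bm_init_def discrete_equilibria_def)
next
  case (step s t)
  obtain L E L' E' where st: "s = (L, E)" "t = (L', E')"
    by (metis surj_pair)
  have inv: "\<forall>Y \<in># L. strategy_set own m g Y" "E \<subseteq> discrete_equilibria own \<theta> m g"
    "discrete_equilibria own \<theta> m g \<subseteq> E \<union> \<Union> (set_mset L)"
    using step.IH unfolding st bm_invariant_def by auto
  obtain Y R K where branch:
    "L = add_mset Y R" "L' = R + K"
    "\<And>W. W \<in># K \<Longrightarrow> \<exists>C. is_box C \<and> W = Y \<inter> C"
    "E \<subseteq> E'" "E' \<subseteq> E \<union> discrete_equilibria own \<theta> m g"
    "discrete_equilibria own \<theta> m g \<inter> Y \<subseteq> E' \<union> \<Union> (set_mset K)"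
    by (rule bm_step_branching[OF step.hyps(2,1)[unfolded st] specs inv(1)]) (rule that; assumption)
  have "strategy_set own m g W" if "W \<in># L'" for W
    using that inv(1) branch(1,2) branch(3)[of W] strategy_set_Int_box[of own m g Y] by auto
  moreover have "E' \<subseteq> discrete_equilibria own \<theta> m g"
    using inv(2) branch(5) by blast
  moreover have "discrete_equilibria own \<theta> m g \<subseteq> E' \<union> \<Union> (set_mset L')"
  proof
    fix z assume z: "z \<in> discrete_equilibria own \<theta> m g"
    then have "z \<in> E \<or> z \<in> Y \<or> z \<in> \<Union> (set_mset R)"
      using inv(3) branch(1) by auto
    then show "z \<in> E' \<union> \<Union> (set_mset L')"
      using z branch(2,4,6) by auto
  qed
  ultimately show ?case
    unfolding st bm_invariant_def by simp
qed

text \<open>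
  A cut may return any number of boxes, and a cell may meet several of them, so the total number
  of cells met by the list can grow. Only each new set by itself meets fewer cells than \<open>Y\<close>,
  hence the multiset ordering.
\<close>

lemma bm_step_decreases:
  assumes nep: "nep_assms own \<theta> m g"
    and cpt: "compact (feasible own m g)"
    and specs: "tools_meet_specs own \<theta> m g Orac Solv Filt Cut"
    and reach: "(bm_step Orac Solv Filt Cut)\<^sup>*\<^sup>* (bm_init own m g) s"
    and step: "bm_step Orac Solv Filt Cut s t"
  shows "(image_mset (\<lambda>Y. card (cell ` Y)) (fst t), image_mset (\<lambda>Y. card (cell ` Y)) (fst s))
           \<in> mult1 less_than"
proof -
  obtain L E L' E' where st: "s = (L, E)" "t = (L', E')"
    by (metis surj_pair)
  have strat: "\<forall>Y \<in># L. strategy_set own m g Y"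
    using bm_invariant_reachable[OF nep specs reach] unfolding st bm_invariant_def by simp
  obtain Y R K x where branch:
    "L = add_mset Y R" "L' = R + K" "x \<in> Y"
    "\<And>W. W \<in># K \<Longrightarrow> \<exists>C. is_box C \<and> W = Y \<inter> C"
    "\<And>W. W \<in># K \<Longrightarrow> cell x \<notin> cell ` W"
    by (rule bm_step_branching[OF step[unfolded st] reach[unfolded st] specs strat]) (rule that; assumption)
  have "bounded Y"
    using bounded_subset[OF compact_imp_bounded[OF cpt] strategy_set_subset_feasible]
      strat branch(1) by auto
  have "card (cell ` W) < card (cell ` Y)" if "W \<in># K" for W
  proof (rule psubset_card_mono[OF finite_cells[OF \<open>bounded Y\<close>]])
    show "cell ` W \<subset> cell ` Y"
      using branch(3) branch(4,5)[OF that] by blast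
  qed
  then show ?thesis
    unfolding st mult1_def mem_Collect_eq case_prod_conv
    by (intro exI[of _ "card (cell ` Y)"] exI[of _ "image_mset (\<lambda>Y. card (cell ` Y)) R"]
        exI[of _ "image_mset (\<lambda>Y. card (cell ` Y)) K"]) (auto simp: branch(1,2))
qed

lemma bm_progress:
  assumes specs: "tools_meet_specs own \<theta> m g Orac Solv Filt Cut"
    and reach: "(bm_step Orac Solv Filt Cut)\<^sup>*\<^sup>* (bm_init own m g) (L, E)"
    and Y: "Y \<in># L" "strategy_set own m g Y"
  shows "\<exists>s. bm_step Orac Solv Filt Cut (L, E) s"
proof -
  obtain R where L: "L = add_mset Y R"
    using Y(1) by (metis mset_add)
  have "solver_spec own \<theta> m g Solv Y"
    using specs reach Y(1) unfolding tools_meet_specs_def by blast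
  then obtain x where x: "Solv Y x" "x \<in> Y"
    using Y(2) unfolding solver_spec_def continuous_equilibrium_def by blast
  have "filter_spec own \<theta> m g Filt Y x"
    using specs reach Y(1) x(1) unfolding tools_meet_specs_def by blast
  then obtain B where B: "Filt Y x B"
    using Y(2) unfolding filter_spec_def by blast
  show ?thesis
  proof (cases "x \<in> int_points")
    case True
    then have "cut_spec own m g Cut Y x"
      using specs reach Y(1) x(1) unfolding tools_meet_specs_def by blast
    then obtain Bs where "Cut Y x Bs"
      using Y(2) x(2) True unfolding cut_spec_def by blast
    then show ?thesis
      unfolding L using bm_step.integral[of Solv Y x Filt B Cut Bs] x(1) B True by metis
  next
    case False
    then obtain i where "x $ i \<notin> \<int>"
      unfolding int_points_def by blast
    then show ?thesis
      unfolding L using bm_step.fractional[of Solv Y x Filt B i] x(1) B False by metis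
  qed
qed

theorem mainTheorem5:
  fixes own :: "'i::finite \<Rightarrow> 'p::finite"
    and \<theta> :: "'p \<Rightarrow> real ^ 'i \<Rightarrow> real"
    and m :: "'p \<Rightarrow> nat"
    and g :: "'p \<Rightarrow> nat \<Rightarrow> real ^ 'i \<Rightarrow> real"
    and Orac :: "real ^ 'i \<Rightarrow> bool"
    and Solv :: "'i solver"
    and Filt :: "'i box_tool"
    and Cut :: "'i cut_tool"
  assumes "nep_assms own \<theta> m g"
    and "compact (feasible own m g)"
    and "tools_meet_specs own \<theta> m g Orac Solv Filt Cut"
  shows "(\<nexists>\<sigma> :: nat \<Rightarrow> 'i bm_state. \<sigma> 0 = bm_init own m g \<and>
            (\<forall>k. bm_step Orac Solv Filt Cut (\<sigma> k) (\<sigma> (Suc k)))) \<and>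
         (\<forall>L E. (bm_step Orac Solv Filt Cut)\<^sup>*\<^sup>* (bm_init own m g) (L, E) \<longrightarrow>
            (L \<noteq> {#} \<longrightarrow> (\<exists>s. bm_step Orac Solv Filt Cut (L, E) s)) \<and>
            (L = {#} \<longrightarrow> E = discrete_equilibria own \<theta> m g))"
proof -
  let ?step = "bm_step Orac Solv Filt Cut"
  let ?\<mu> = "\<lambda>s :: 'i bm_state. image_mset (\<lambda>Y. card (cell ` Y)) (fst s)"
  have "\<nexists>\<sigma>. \<sigma> 0 = bm_init own m g \<and> (\<forall>k. ?step (\<sigma> k) (\<sigma> (Suc k)))"
  proof
    assume "\<exists>\<sigma>. \<sigma> 0 = bm_init own m g \<and> (\<forall>k. ?step (\<sigma> k) (\<sigma> (Suc k)))"
    then obtain \<sigma> where \<sigma>: "\<sigma> 0 = bm_init own m g" "\<And>k. ?step (\<sigma> k) (\<sigma> (Suc k))"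
      by blast
    have "?step\<^sup>*\<^sup>* (bm_init own m g) (\<sigma> k)" for k
      by (induction k) (use \<sigma> in \<open>auto intro: rtranclp.rtrancl_into_rtrancl\<close>)
    then have "(?\<mu> (\<sigma> (Suc k)), ?\<mu> (\<sigma> k)) \<in> mult1 less_than" for k
      using bm_step_decreases[OF assms] \<sigma>(2) by blast
    then have "\<exists>f. \<forall>k. (f (Suc k), f k) \<in> mult1 less_than"
      by (intro exI[of _ "\<lambda>k. ?\<mu> (\<sigma> k)"]) simp
    then show False
      using wf_mult1[OF wf_less_than] unfolding wf_iff_no_infinite_down_chain by simp
  qed
  moreover have "(L \<noteq> {#} \<longrightarrow> (\<exists>s. ?step (L, E) s)) \<and> (L = {#} \<longrightarrow> E = discrete_equilibria own \<theta> m g)"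
    if reach: "?step\<^sup>*\<^sup>* (bm_init own m g) (L, E)" for L E
  proof (intro conjI impI)
    note inv = bm_invariant_reachable[OF assms(1,3) reach]
    show "\<exists>s. ?step (L, E) s" if "L \<noteq> {#}"
      using that inv bm_progress[OF assms(3) reach] unfolding bm_invariant_def
      by (metis fst_conv multiset_nonemptyE)
    show "E = discrete_equilibria own \<theta> m g" if "L = {#}"
      using that inv unfolding bm_invariant_def by auto
  qed
  ultimately show ?thesis
    by blast
qed

end
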